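(* Let $f(x)$ be a real polynomial of degree $k$ with irrational leading coefficient, and let $\gamma=4^{1-k}$. Let $\epsilon>0$. Then there are infinitely many positive integers $n$ having at least three divisors (i.e. $\tau(n)\geq 3$) such that $$\|f(n)\|<n^{-\gamma/4+\epsilon}.$$
   Context: $\|x\|$ denotes the distance from the real number $x$ to the nearest integer; $\tau(n)$ is the number of positive divisors of $n$. *)

theory Defs
  imports Complex_Main "HOL-Computational_Algebra.Polynomial"
begin

text \<open>The distance from a real number to the nearest integer. At half-integers the tie-breaking
  convention of \<open>round\<close> does not affect the value.\<close>

definition nearest_int_dist :: "real \<Rightarrow> real" where
  "nearest_int_dist x = \<bar>x - of_int (round x)\<bar>"

text \<open>Only meaningful for positive arguments: the set of divisors of \<open>0\<close> is infinite, so
  \<open>divisor_count 0 = 0\<close>.\<close>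

definition divisor_count :: "nat \<Rightarrow> nat" where
  "divisor_count n = card {d. d dvd n}"

end

theory Submission
  imports Defs "HOL-Analysis.Kronecker_Approximation_Theorem"
begin

text \<open>Numbers \<open>n = 2 m\<close> with \<open>m \<ge> 2\<close> have at least three divisors, so it suffices to make
  \<open>p m = f (2 m)\<close> close to an integer. Put \<open>K = 2\<^sup>k\<^sup>-\<^sup>1\<close> and let \<open>a / q\<close> be a reduced fraction with
  \<open>\<bar>\<alpha> - a / q\<bar> < 1 / q\<^sup>2\<close>, where \<open>\<alpha>\<close> is the leading coefficient of \<open>p\<close>; then \<open>m \<alpha>\<close> has distance at least
  \<open>1 / (2 q)\<close> from the integers for \<open>1 \<le> m \<le> q / 2\<close>. Weyl differencing turns this into a bound
  \<open>N / (2 H)\<close> for the exponential sums of \<open>h p\<close> over \<open>N\<close> consecutive integers, for all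
  \<open>0 < \<bar>h\<bar> < H\<close>, where \<open>q\<close> is about \<open>H\<close> to the power \<open>K (K - 1) + 1\<close> and \<open>N\<close> about \<open>H\<close> to the power
  \<open>K\<^sup>2 + 1\<close>. Fejer's kernel then yields \<open>m\<close> between \<open>N\<close> and \<open>2 N\<close> such that \<open>p m\<close> has distance less than
  \<open>2 / sqrt H\<close> from the integers, and \<open>2 (K\<^sup>2 + 1) \<le> 4 K\<^sup>2 = 4 / \<gamma>\<close>.\<close>

section \<open>Distance to the nearest integer\<close>

lemma nearest_int_dist_le: "nearest_int_dist x \<le> \<bar>x - of_int m\<bar>"
  unfolding nearest_int_dist_def by (rule round_diff_minimal)

lemma nearest_int_dist_le_half: "nearest_int_dist x \<le> 1 / 2"
  unfolding nearest_int_dist_def by (metis abs_minus_commute of_int_round_abs_le)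

lemma nearest_int_dist_minus: "nearest_int_dist (- x) = nearest_int_dist x"
proof -
  have le: "nearest_int_dist (- y) \<le> nearest_int_dist y" for y
  proof -
    have "nearest_int_dist (- y) \<le> \<bar>- y - of_int (- round y)\<bar>"
      by (rule nearest_int_dist_le)
    also have "\<dots> = nearest_int_dist y"
      by (simp add: nearest_int_dist_def)
    finally show ?thesis .
  qed
  show ?thesis
    using le[of x] le[of "- x"] by simp
qed

lemma nearest_int_dist_diff: "nearest_int_dist (x - y) \<le> nearest_int_dist x + nearest_int_dist y"
proof -
  have "nearest_int_dist (x - y) \<le> \<bar>(x - y) - of_int (round x - round y)\<bar>"
    by (rule nearest_int_dist_le)
  then show ?thesis
    unfolding nearest_int_dist_def by simp
qed

text \<open>With \<open>y = pi * t\<close> reduced to \<open>\<bar>y\<bar> \<le> 2\<close>, the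
  cubic Taylor bound costs at most two thirds of \<open>\<bar>y\<bar>\<close>, and the remaining
  third is at least \<open>\<bar>t\<bar>\<close> because pi exceeds 3.\<close>

lemma nearest_int_dist_le_abs_sin: "nearest_int_dist x \<le> \<bar>sin (pi * x)\<bar>"
proof -
  define t where "t = x - of_int (round x)"
  define y where "y = pi * t"
  have t: "\<bar>t\<bar> \<le> 1 / 2" and d: "nearest_int_dist x = \<bar>t\<bar>"
    using nearest_int_dist_le_half[of x] by (auto simp: t_def nearest_int_dist_def)
  have "\<bar>y\<bar> = pi * \<bar>t\<bar>"
    by (simp add: y_def abs_mult)
  then have y2: "\<bar>y\<bar> \<le> 2" and y3: "\<bar>y\<bar> \<ge> 3 * \<bar>t\<bar>"
    using mult_mono[of pi 4 "\<bar>t\<bar>" "1/2"] t pi_less_4 mult_right_mono[of 3 pi "\<bar>t\<bar>"] pi_gt3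
    by auto
  have "\<bar>sin y - y\<bar> \<le> \<bar>y\<bar> ^ 3 / 6"
    using Maclaurin_sin_bound[of y 3] by (simp add: sin_coeff_def lessThan_nat_numeral fact_numeral)
  also have "\<bar>y\<bar> ^ 3 \<le> 4 * \<bar>y\<bar>"
    using mult_right_mono[of "\<bar>y\<bar> ^ 2" "2 ^ 2" "\<bar>y\<bar>"] power_mono[OF y2, of 2]
    by (simp add: power3_eq_cube power2_eq_square mult.assoc)
  finally have "\<bar>sin y\<bar> \<ge> \<bar>t\<bar>"
    using y3 by linarith
  moreover have "pi * x = y + pi * of_int (round x)"
    by (simp add: y_def t_def algebra_simps)
  then have "\<bar>sin (pi * x)\<bar> = \<bar>sin y\<bar>"
    by (simp add: sin_add abs_mult)
  ultimately show ?thesis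
    using d by simp
qed

section \<open>Exponential sums\<close>

definition unit_char :: "real \<Rightarrow> complex" where
  "unit_char x = cis (2 * pi * x)"

lemma norm_unit_char [simp]: "norm (unit_char x) = 1"
  by (simp add: unit_char_def)

lemma unit_char_add: "unit_char (x + y) = unit_char x * unit_char y"
  by (simp add: unit_char_def cis_mult distrib_left)

lemma unit_char_diff: "unit_char (x - y) = unit_char x * cnj (unit_char y)"
  by (simp add: unit_char_def cis_cnj cis_mult algebra_simps)

lemma unit_char_0 [simp]: "unit_char 0 = 1"
  by (simp add: unit_char_def)

lemma unit_char_of_nat_mult: "unit_char (of_nat n * x) = unit_char x ^ n"
  by (simp add: unit_char_def Complex.DeMoivre mult_ac)

lemma norm_unit_char_minus_1: "norm (unit_char x - 1) = 2 * \<bar>sin (pi * x)\<bar>"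
  using dist_exp_i_1[of "2 * pi * x"] by (simp add: unit_char_def cis_conv_exp)

lemma norm_sum_unit_char_le_card: "norm (\<Sum>n\<in>A. unit_char (P n)) \<le> card A"
  using norm_sum[of "\<lambda>n. unit_char (P n)" A] by simp

text \<open>In the closed form of the geometric sum the numerator has norm at most 2 and the
  denominator has norm \<open>2 * \<bar>sin (pi * x)\<bar>\<close>.\<close>

lemma norm_geometric_unit_char_le:
  assumes "nearest_int_dist x > 0"
  shows "norm (\<Sum>i<n. unit_char (of_nat i * x)) \<le> 1 / nearest_int_dist x"
proof -
  have s: "\<bar>sin (pi * x)\<bar> \<ge> nearest_int_dist x"
    by (rule nearest_int_dist_le_abs_sin)
  then have ne: "unit_char x \<noteq> 1"
    using norm_unit_char_minus_1[of x] assms by auto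
  have "norm (\<Sum>i<n. unit_char (of_nat i * x)) = norm (unit_char x ^ n - 1) / norm (unit_char x - 1)"
    by (simp add: unit_char_of_nat_mult geometric_sum[OF ne] norm_divide)
  also have "\<dots> \<le> 2 / norm (unit_char x - 1)"
    using norm_triangle_ineq4[of "unit_char x ^ n" 1] by (intro divide_right_mono) (auto simp: norm_power)
  also have "\<dots> \<le> 1 / nearest_int_dist x"
    using s assms by (simp add: norm_unit_char_minus_1 field_simps)
  finally show ?thesis .
qed

lemma norm_linear_unit_char_sum_le:
  fixes a b :: int
  assumes "nearest_int_dist \<beta> > 0"
  shows "norm (\<Sum>n\<in>{a..<b}. unit_char (\<beta> * of_int n + c)) \<le> 1 / nearest_int_dist \<beta>"
proof -
  have eq: "(\<Sum>n\<in>{a..<b}. unit_char (\<beta> * of_int n + c)) =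
      (\<Sum>i<nat (b - a). unit_char (of_nat i * \<beta>) * unit_char (\<beta> * of_int a + c))"
    by (rule sum.reindex_bij_witness[of _ "\<lambda>i. a + int i" "\<lambda>n. nat (n - a)"])
      (auto simp: unit_char_add[symmetric] algebra_simps)
  show ?thesis
    using norm_geometric_unit_char_le[OF assms, of "nat (b - a)"]
    by (simp add: eq sum_distrib_right[symmetric] norm_mult)
qed

text \<open>Weyl's squaring step: expand the square as a sum over pairs \<open>(m, n)\<close> and
  group them by \<open>d = m - n\<close>. For fixed \<open>d\<close>, \<open>n\<close> runs over the
  intersection of the interval with its translate by \<open>-d\<close>.\<close>

lemma norm_sum_unit_char_square_le:
  fixes a b N :: int
  assumes "b - a \<le> N"
  shows "(norm (\<Sum>n\<in>{a..<b}. unit_char (P n)))\<^sup>2 \<le>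
    (\<Sum>d\<in>{-N<..<N}. norm (\<Sum>n\<in>{max a (a - d)..<min b (b - d)}. unit_char (P (n + d) - P n)))"
proof -
  let ?I = "{a..<b}"
  let ?J = "\<lambda>d. {max a (a - d)..<min b (b - d)}"
  let ?S = "\<Sum>n\<in>?I. unit_char (P n)"
  have "?S * cnj ?S = (\<Sum>(m, n)\<in>?I \<times> ?I. unit_char (P m - P n))"
    by (simp add: unit_char_diff sum_product sum.cartesian_product)
  also have "\<dots> = (\<Sum>(d, n)\<in>(SIGMA d:{-N<..<N}. ?J d). unit_char (P (n + d) - P n))"
    using assms
    by (intro sum.reindex_bij_witness[of _ "\<lambda>(d, n). (n + d, n)" "\<lambda>(m, n). (m - n, n)"]) auto
  also have "\<dots> = (\<Sum>d\<in>{-N<..<N}. \<Sum>n\<in>?J d. unit_char (P (n + d) - P n))"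
    by (subst sum.Sigma) auto
  finally have "(norm ?S)\<^sup>2 = norm (\<Sum>d\<in>{-N<..<N}. \<Sum>n\<in>?J d. unit_char (P (n + d) - P n))"
    by (metis complex_mod_mult_cnj)
  also have "\<dots> \<le> (\<Sum>d\<in>{-N<..<N}. norm (\<Sum>n\<in>?J d. unit_char (P (n + d) - P n)))"
    by (rule norm_sum)
  finally show ?thesis .
qed

section \<open>Weyl differencing\<close>

text \<open>The functions whose \<open>(j+1)\<close>-st difference with steps \<open>d\<^sub>1, \<dots>, d\<^sub>j, 1\<close> is the constant
  \<open>\<beta> d\<^sub>1 \<cdots> d\<^sub>j\<close>; for a polynomial of degree \<open>j + 1\<close>, \<open>\<beta>\<close> is \<open>(j + 1)!\<close> times the leading coefficient.\<close>

primrec weyl_phase :: "nat \<Rightarrow> real \<Rightarrow> (int \<Rightarrow> real) \<Rightarrow> bool" where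
  "weyl_phase 0 \<beta> P = (\<exists>c. \<forall>n. P n = \<beta> * of_int n + c)"
| "weyl_phase (Suc j) \<beta> P = (\<forall>d. weyl_phase j (\<beta> * of_int d) (\<lambda>n. P (n + d) - P n))"

text \<open>Differencing is linear; this allows passing from a polynomial to its multiples by the
  Fejer frequencies \<open>h\<close>.\<close>

lemma weyl_phase_scale: "weyl_phase j \<beta> P \<Longrightarrow> weyl_phase j (h * \<beta>) (\<lambda>n. h * P n)"
proof (induction j arbitrary: \<beta> P)
  case 0
  then obtain c where "\<forall>n. P n = \<beta> * of_int n + c"
    by auto
  then show ?case
    by (auto intro!: exI[of _ "h * c"] simp: algebra_simps)
next
  case (Suc j)
  show ?case
  proof (unfold weyl_phase.simps, intro allI)
    fix d
    have "weyl_phase j (\<beta> * of_int d) (\<lambda>n. P (n + d) - P n)"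
      using Suc.prems by simp
    from Suc.IH[OF this] show "weyl_phase j (h * \<beta> * of_int d) (\<lambda>n. h * P (n + d) - h * P n)"
      by (simp add: algebra_simps)
  qed
qed

section \<open>Differences of polynomials\<close>

lemma degree_shift_le: "degree (pcompose p [:d, 1:]) \<le> degree (p :: real poly)"
  using degree_pcompose_le[of p "[:d, 1:]"] by simp

lemma coeff_shift_top:
  fixes p :: "real poly"
  assumes "degree p \<le> n"
  shows "coeff (pcompose p [:d, 1:]) n = coeff p n"
proof (cases "degree p = n")
  case True
  have "lead_coeff (pcompose p [:d, 1:]) = lead_coeff p"
    by (subst lead_coeff_comp) auto
  then show ?thesis
    using True by (simp add: degree_pcompose)
next
  case False
  then show ?thesis
    using assms degree_shift_le[of p d] by (simp add: coeff_eq_0)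
qed

text \<open>Induction by a discrete product rule: the difference of \<open>a + x p(x)\<close> is
  \<open>d p(x + d)\<close> plus \<open>x\<close> times the difference of \<open>p\<close>. The top
  coefficient thus collects 1 from the first term and the previous degree from the second.\<close>

lemma poly_difference:
  fixes p :: "real poly"
  assumes "degree p \<le> Suc n"
  shows "degree (pcompose p [:d, 1:] - p) \<le> n \<and>
    coeff (pcompose p [:d, 1:] - p) n = of_nat (Suc n) * d * coeff p (Suc n)"
  using assms
proof (induction p arbitrary: n)
  case 0
  then show ?case by simp
next
  case (pCons a p)
  let ?s = "\<lambda>p. pcompose p [:d, 1:]"
  have eq: "?s (pCons a p) - pCons a p = smult d (?s p) + pCons 0 (?s p - p)"
    by (simp add: pcompose_pCons)
  have deg: "degree p \<le> n"
    using pCons.prems pCons.hyps by (auto split: if_splits)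
  show ?case
  proof (cases n)
    case 0
    then obtain c where "p = [:c:]"
      using deg degree_eq_zeroE by auto
    then show ?thesis
      by (simp add: 0 pcompose_pCons)
  next
    case (Suc m)
    have IH: "degree (?s p - p) \<le> m" "coeff (?s p - p) m = of_nat (Suc m) * d * coeff p (Suc m)"
      using pCons.IH[of m] deg Suc by auto
    have "degree (pCons 0 (?s p - p)) \<le> n"
      using IH(1) Suc by (meson Suc_le_mono degree_pCons_le le_trans)
    moreover have "degree (smult d (?s p)) \<le> n"
      using degree_smult_le[of d "?s p"] degree_shift_le[of p d] deg by linarith
    ultimately show ?thesis
      unfolding eq using IH(2) Suc coeff_shift_top[OF deg, of d]
      by (simp add: degree_add_le algebra_simps)
  qed
qed

text \<open>Each difference lowers the degree by one and multiplies the top coefficient by the old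
  degree and the step; the degrees accumulate to the factorial.\<close>

lemma weyl_phase_poly:
  assumes "degree p \<le> Suc j"
  shows "weyl_phase j (fact (Suc j) * coeff p (Suc j)) (\<lambda>n. poly p (of_int n))"
  using assms
proof (induction j arbitrary: p)
  case 0
  then have "p = [:coeff p 0, coeff p 1:]"
    by (intro poly_eqI) (auto simp: coeff_pCons coeff_eq_0 split: nat.splits)
  then have "poly p x = coeff p 1 * x + coeff p 0" for x
    by (metis add.commute mult.commute poly_pCons poly_0 mult_zero_right add_0_right)
  then show ?case
    by auto
next
  case (Suc j)
  show ?case
  proof (unfold weyl_phase.simps, intro allI)
    fix d :: int
    let ?q = "pcompose p [:of_int d, 1:] - p"
    have q: "degree ?q \<le> Suc j"
      "coeff ?q (Suc j) = of_nat (Suc (Suc j)) * of_int d * coeff p (Suc (Suc j))"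
      using poly_difference[OF Suc.prems, of "of_int d"] by auto
    have "fact (Suc (Suc j)) * coeff p (Suc (Suc j)) * of_int d = fact (Suc j) * coeff ?q (Suc j)"
      unfolding q(2) fact_Suc[of "Suc j"] of_nat_mult by (simp only: mult_ac)
    moreover have "poly p (of_int (n + d)) - poly p (of_int n) = poly ?q (of_int n)" for n
      by (simp add: poly_pcompose add.commute)
    ultimately show "weyl_phase j (fact (Suc (Suc j)) * coeff p (Suc (Suc j)) * of_int d)
        (\<lambda>n. poly p (of_int (n + d)) - poly p (of_int n))"
      using Suc.IH[OF q(1)] by presburger
  qed
qed

section \<open>Weyl's inequality\<close>

text \<open>A quantitative irrationality condition replacing the fraction \<open>a / q\<close> of
  the classical Weyl inequality; unlike that fraction, it passes directly to most products
  \<open>\<beta> * d\<close>.\<close>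

definition far_multiples :: "nat \<Rightarrow> real \<Rightarrow> real \<Rightarrow> bool" where
  "far_multiples Q R \<beta> \<longleftrightarrow> (\<forall>m\<in>{1..Q}. 1 / R \<le> nearest_int_dist (of_nat m * \<beta>))"

text \<open>If \<open>d < e\<close> are both counted, then \<open>q (e - d) \<beta>\<close> is
  closer than \<open>1 / R\<close> to an integer, which forces \<open>q (e - d) > Q\<close>. So the
  counted points are spaced by more than \<open>Q / q\<close> in an interval of length
  \<open>2 N\<close>.\<close>

lemma card_close_multiples_le:
  fixes q Q N :: nat
  assumes far: "far_multiples Q R \<beta>" and Q: "Q > 0" and q: "q > 0"
  shows "real (card {d\<in>{- int N<..<int N}.
      nearest_int_dist (of_nat q * (\<beta> * of_int d)) < 1 / (2 * R)}) \<le> 2 * N * q / Q + 1"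
    (is "real (card ?D) \<le> _")
proof -
  \<comment> \<open>The index of the cell of length \<open>Q / q\<close> containing
    \<open>d\<close>, counted from \<open>-N\<close>; the spacing makes it injective.\<close>
  let ?f = "\<lambda>d. nat ((d + int N) * int q div int Q)"
  have sep: "int q * (e - d) > int Q" if "d \<in> ?D" "e \<in> ?D" "d < e" for d e
  proof (rule ccontr)
    assume le: "\<not> int q * (e - d) > int Q"
    define m where "m = nat (int q * (e - d))"
    have m: "int m = int q * (e - d)" "m \<in> {1..Q}"
      using le q that(3) by (auto simp: m_def nat_le_iff zero_less_mult_iff Suc_le_eq)
    have "real m = real q * (of_int e - of_int d)"
      by (metis m(1) of_int_diff of_int_mult of_int_of_nat_eq)
    then have "real m * \<beta> = real q * (of_int e - of_int d) * \<beta>"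
      by simp
    also have "\<dots> = of_nat q * (\<beta> * of_int e) - of_nat q * (\<beta> * of_int d)"
      by (simp add: algebra_simps)
    finally have "real m * \<beta> = of_nat q * (\<beta> * of_int e) - of_nat q * (\<beta> * of_int d)" .
    then have "nearest_int_dist (real m * \<beta>) < 1 / (2 * R) + 1 / (2 * R)"
      using nearest_int_dist_diff[of "of_nat q * (\<beta> * of_int e)" "of_nat q * (\<beta> * of_int d)"] that
      by auto
    also have "\<dots> = 1 / R"
      by simp
    finally show False
      using far m(2) unfolding far_multiples_def by (meson not_le)
  qed
  have lt: "?f d < ?f e" if "d \<in> ?D" "e \<in> ?D" "d < e" for d e
  proof -
    have "(d + int N) * int q + int Q \<le> (e + int N) * int q"
      using sep[OF that] by (simp add: algebra_simps)
    then have "((d + int N) * int q + int Q) div int Q \<le> (e + int N) * int q div int Q"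
      using Q by (intro zdiv_mono1) auto
    moreover have "((d + int N) * int q + int Q) div int Q = (d + int N) * int q div int Q + 1"
      using Q by simp
    moreover have "(d + int N) * int q div int Q \<ge> 0"
      using that(1) Q by (auto simp: pos_imp_zdiv_nonneg_iff)
    ultimately show ?thesis
      by linarith
  qed
  have "inj_on ?f ?D"
  proof (rule inj_onI)
    fix d e assume "d \<in> ?D" "e \<in> ?D" "?f d = ?f e"
    then show "d = e"
      using lt[of d e] lt[of e d] by (metis less_irrefl linorder_less_linear)
  qed
  moreover have "?f ` ?D \<subseteq> {..2 * N * q div Q}"
  proof
    fix y assume "y \<in> ?f ` ?D"
    then obtain d where d: "d \<in> ?D" "y = ?f d"
      by blast
    have "(d + int N) * int q div int Q \<le> int (2 * N * q) div int Q"
      using d(1) Q by (intro zdiv_mono1) (auto intro!: mult_right_mono)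
    then show "y \<in> {..2 * N * q div Q}"
      using d(2) by (simp add: nat_le_iff zdiv_int)
  qed
  ultimately have "card ?D \<le> card {..2 * N * q div Q}"
    by (intro card_inj_on_le) auto
  then have "real (card ?D) \<le> real (2 * N * q div Q) + 1"
    by simp
  also have "real (2 * N * q div Q) \<le> real (2 * N * q) / real Q"
    by (rule of_nat_div_le_of_nat)
  finally show ?thesis
    by simp
qed

text \<open>Union bound over the multiplier \<open>q \<le> Q'\<close> that witnesses the
  failure.\<close>

lemma card_not_far_multiples_le:
  fixes Q Q' N :: nat
  assumes far: "far_multiples Q R \<beta>" and Q: "Q > 0"
  shows "real (card {d\<in>{- int N<..<int N}. \<not> far_multiples Q' (2 * R) (\<beta> * of_int d)}) \<le>
    2 * N * (real Q')\<^sup>2 / Q + Q'"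
proof -
  let ?D = "\<lambda>q. {d\<in>{- int N<..<int N}. nearest_int_dist (of_nat q * (\<beta> * of_int d)) < 1 / (2 * R)}"
  have "{d\<in>{- int N<..<int N}. \<not> far_multiples Q' (2 * R) (\<beta> * of_int d)} = (\<Union>q\<in>{1..Q'}. ?D q)"
    unfolding far_multiples_def by (auto simp: not_le)
  then have "card {d\<in>{- int N<..<int N}. \<not> far_multiples Q' (2 * R) (\<beta> * of_int d)} \<le>
      (\<Sum>q\<in>{1..Q'}. card (?D q))"
    using card_UN_le[of "{1..Q'}" ?D] by simp
  then have "real (card {d\<in>{- int N<..<int N}. \<not> far_multiples Q' (2 * R) (\<beta> * of_int d)}) \<le>
      real (\<Sum>q\<in>{1..Q'}. card (?D q))"
    by (simp only: of_nat_le_iff)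
  also have "\<dots> = (\<Sum>q\<in>{1..Q'}. real (card (?D q)))"
    by simp
  also have "\<dots> \<le> (\<Sum>q\<in>{1..Q'}. 2 * N * Q' / Q + 1)"
  proof (rule sum_mono)
    fix q assume q: "q \<in> {1..Q'}"
    have "real (card (?D q)) \<le> 2 * N * q / Q + 1"
      using q Q by (intro card_close_multiples_le[OF far]) auto
    also have "\<dots> \<le> 2 * N * Q' / Q + 1"
      using q by (intro add_mono divide_right_mono) (auto intro!: mult_left_mono)
    finally show "real (card (?D q)) \<le> 2 * N * Q' / Q + 1" .
  qed
  also have "\<dots> = 2 * N * (real Q')\<^sup>2 / Q + Q'"
    by (simp add: power2_eq_square algebra_simps)
  finally show ?thesis .
qed

text \<open>A version of Weyl's inequality which avoids the divisor bound: for most \<open>d\<close> the multiples of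
  \<open>\<beta> d\<close> are again far from the integers, at the price of a square root in the range of multiples. The
  constant 3 reproduces itself since \<open>2 \<cdot> 3 + 3 = 3\<^sup>2\<close>.\<close>

lemma weyl_sum_bound:
  fixes b N K R :: nat and u v :: int
  assumes "weyl_phase j \<beta> P" and K: "K = 2 ^ j" and b: "b \<ge> 1" and R: "R > 0"
    and "far_multiples (b ^ (K * (K - 1))) R \<beta>"
    and "2 ^ j * R * b ^ K \<le> N" and "b ^ (K * K) \<le> N" and "v - u \<le> int N"
  shows "norm (\<Sum>n\<in>{u..<v}. unit_char (P n)) \<le> 3 * N / b"
  using assms
proof (induction j arbitrary: \<beta> P b K R u v)
  case 0
  then obtain c where c: "\<And>n. P n = \<beta> * of_int n + c"
    by auto
  \<comment> \<open>Here \<open>K = 1\<close>, so the range of multiples is just 1 and the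
    hypothesis concerns \<open>\<beta>\<close> itself.\<close>
  have far: "1 / R \<le> nearest_int_dist \<beta>"
    using "0.prems" by (simp add: far_multiples_def)
  then have pos: "nearest_int_dist \<beta> > 0"
    using "0.prems"(4) less_le_trans[of 0 "1 / real R"] by simp
  have "norm (\<Sum>n\<in>{u..<v}. unit_char (P n)) \<le> 1 / nearest_int_dist \<beta>"
    unfolding c by (rule norm_linear_unit_char_sum_le[OF pos])
  also have "\<dots> \<le> R"
    using far pos "0.prems"(4) by (simp add: field_simps)
  also have "\<dots> \<le> N / b"
  proof -
    have "R * b \<le> N"
      using "0.prems" by simp
    then have "real R * real b \<le> N"
      by (metis of_nat_le_iff of_nat_mult)
    then show ?thesis
      using "0.prems"(3) by (simp add: field_simps)
  qed
  also have "\<dots> \<le> 3 * N / b"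
    by (simp add: divide_right_mono)
  finally show ?case .
next
  case (Suc j)
  define L :: nat where "L = 2 ^ j"
  have L: "K = 2 * L" "L \<ge> 1"
    using Suc.prems(2) by (auto simp: L_def)
  then obtain l where l: "L = Suc l"
    by (metis One_nat_def Suc_le_D)
  \<comment> \<open>The first inequality will give \<open>Q'^2 b^2 \<le> Q\<close>, the second
    \<open>Q' b^2 \<le> N\<close>; these control the two terms in the count of bad
    \<open>d\<close>.\<close>
  have ex: "2 * (L * (L - 1)) * 2 + 2 \<le> K * (K - 1)" "2 * (L * (L - 1)) + 2 \<le> K * K"
    unfolding L(1) l by (simp_all add: algebra_simps)
  define Q where "Q = b ^ (K * (K - 1))"
  define Q' where "Q' = b\<^sup>2 ^ (L * (L - 1))"
  define S where "S = (\<lambda>d. norm (\<Sum>n\<in>{max u (u - d)..<min v (v - d)}. unit_char (P (n + d) - P n)))"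
  let ?D = "{- int N<..<int N}"
  \<comment> \<open>The bad differences, among them \<open>d = 0\<close>, for which there is no
    cancellation.\<close>
  define B where "B = {d\<in>?D. \<not> far_multiples Q' (2 * R) (\<beta> * of_int d)}"
  have b: "real b \<ge> 1" and N: "N \<ge> 1"
    using Suc.prems(3,7) one_le_power[of b "K * K"] by linarith+
  have pw: "b ^ m \<le> N" if "m \<le> K * K" for m
    using power_increasing[OF that Suc.prems(3)] Suc.prems(7) by linarith

  \<comment> \<open>The induction hypothesis is applied with \<open>b^2\<close>, \<open>2 R\<close>
    and \<open>L\<close>, and the same \<open>N\<close>; since \<open>K = 2 L\<close>, the powers
    \<open>b^K\<close> and \<open>(b^2)^L\<close> agree.\<close>
  have good: "S d \<le> 3 * N / b\<^sup>2" if "d \<in> ?D - B" for d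
  proof -
    have "weyl_phase j (\<beta> * of_int d) (\<lambda>n. P (n + d) - P n)"
      using Suc.prems(1) by simp
    moreover have "far_multiples (b\<^sup>2 ^ (L * (L - 1))) (real (2 * R)) (\<beta> * of_int d)"
      using that by (auto simp: B_def Q'_def)
    moreover have "2 ^ j * (2 * R) * (b\<^sup>2) ^ L \<le> N"
      using Suc.prems(6) by (simp add: L(1) power_mult[symmetric] algebra_simps)
    moreover have "b\<^sup>2 ^ (L * L) \<le> N"
      unfolding power_mult[symmetric] by (rule pw) (simp add: L(1))
    moreover have "min v (v - d) - max u (u - d) \<le> int N"
      using Suc.prems(8) by linarith
    moreover have "b\<^sup>2 \<ge> 1" "2 * R > 0"
      using Suc.prems(3,4) by auto
    ultimately show ?thesis
      unfolding S_def by (intro Suc.IH[OF _ L_def])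
  qed

  have bad: "S d \<le> N" if "d \<in> ?D" for d
  proof -
    have "S d \<le> card {max u (u - d)..<min v (v - d)}"
      unfolding S_def by (rule norm_sum_unit_char_le_card)
    also have "card {max u (u - d)..<min v (v - d)} \<le> N"
      using Suc.prems(8) by auto
    finally show ?thesis
      by simp
  qed

  have cB: "card B \<le> 3 * N / b\<^sup>2"
  proof -
    have Qpos: "Q > 0"
      using Suc.prems(3) by (simp add: Q_def)
    have "card B \<le> 2 * N * (real Q')\<^sup>2 / Q + Q'"
      unfolding B_def using card_not_far_multiples_le[of Q "real R" \<beta> N Q'] Suc.prems(5) Qpos
      by (simp add: Q_def)
    also have "(real Q')\<^sup>2 * b\<^sup>2 \<le> Q"
    proof -
      have "Q'\<^sup>2 * b\<^sup>2 = b ^ (2 * (L * (L - 1)) * 2 + 2)"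
        by (simp only: Q'_def power_mult[symmetric] power_add[symmetric])
      also have "\<dots> \<le> Q"
        unfolding Q_def using Suc.prems(3) ex(1) by (intro power_increasing)
      finally show ?thesis
        by (metis of_nat_le_iff of_nat_mult of_nat_power)
    qed
    then have "2 * N * (real Q')\<^sup>2 / Q \<le> 2 * N / b\<^sup>2"
      using Qpos b mult_left_mono[of "(real Q')\<^sup>2 * b\<^sup>2" Q "2 * N"] by (simp add: field_simps)
    also have "real Q' \<le> N / b\<^sup>2"
    proof -
      have "Q' * b\<^sup>2 = b ^ (2 * (L * (L - 1)) + 2)"
        by (simp only: Q'_def power_mult[symmetric] power_add[symmetric])
      also have "\<dots> \<le> N"
        by (rule pw[OF ex(2)])
      finally have "real Q' * (real b)\<^sup>2 \<le> N"
        by (metis of_nat_le_iff of_nat_mult of_nat_power)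
      then show ?thesis
        using b by (simp add: field_simps)
    qed
    finally show ?thesis
      by (simp add: add_divide_distrib[symmetric])
  qed

  have "(norm (\<Sum>n\<in>{u..<v}. unit_char (P n)))\<^sup>2 \<le> (\<Sum>d\<in>?D. S d)"
    unfolding S_def by (rule norm_sum_unit_char_square_le[OF Suc.prems(8)])
  also have "\<dots> = (\<Sum>d\<in>?D - B. S d) + (\<Sum>d\<in>B. S d)"
    by (intro sum.subset_diff) (auto simp: B_def)
  also have "\<dots> \<le> (2 * N) * (3 * N / b\<^sup>2) + (3 * N / b\<^sup>2) * N"
  proof (rule add_mono)
    have "(\<Sum>d\<in>?D - B. S d) \<le> card (?D - B) * (3 * N / b\<^sup>2)"
      by (intro sum_bounded_above good)
    also have "card (?D - B) \<le> card ?D"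
      by (intro card_mono) auto
    then have "real (card (?D - B)) \<le> 2 * N"
      by simp
    then have "card (?D - B) * (3 * N / b\<^sup>2) \<le> (2 * N) * (3 * N / b\<^sup>2)"
      by (intro mult_right_mono) auto
    finally show "(\<Sum>d\<in>?D - B. S d) \<le> (2 * N) * (3 * N / b\<^sup>2)" .
    have "(\<Sum>d\<in>B. S d) \<le> card B * real N"
      using bad by (intro sum_bounded_above) (auto simp: B_def)
    also have "\<dots> \<le> (3 * N / b\<^sup>2) * N"
      by (rule mult_right_mono[OF cB]) simp
    finally show "(\<Sum>d\<in>B. S d) \<le> (3 * N / b\<^sup>2) * N" .
  qed
  also have "\<dots> = (3 * N / b)\<^sup>2"
    by (simp add: power_divide power2_eq_square)
  finally have "(norm (\<Sum>n\<in>{u..<v}. unit_char (P n)))\<^sup>2 \<le> (3 * N / b)\<^sup>2" .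
  then show ?case
    by (rule power2_le_imp_le) simp
qed

section \<open>Small values of polynomials\<close>

text \<open>The Fejer kernel \<open>\<bar>\<Sum>i<H. unit_char (i x)\<bar>\<^sup>2\<close> has mean \<open>H\<close> along \<open>g\<close> up to the exponential sums, while
  it is at most \<open>H / 4\<close> at distance \<open>2 / sqrt H\<close> from the integers.\<close>

lemma exists_close_to_int:
  fixes g :: "int \<Rightarrow> real" and H N :: nat
  assumes H: "H \<ge> 1" and N: "N \<ge> 1"
    and bound: "\<And>h. h \<noteq> 0 \<Longrightarrow> \<bar>h\<bar> < int H \<Longrightarrow>
      norm (\<Sum>n\<in>{u..<u + int N}. unit_char (of_int h * g n)) \<le> N / (2 * H)"
  shows "\<exists>n\<in>{u..<u + int N}. nearest_int_dist (g n) < 2 / sqrt H"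
proof (rule ccontr)
  assume "\<not> ?thesis"
  then have far: "2 / sqrt H \<le> nearest_int_dist (g n)" if "n \<in> {u..<u + int N}" for n
    using that by (auto simp: not_less)
  let ?I = "{u..<u + int N}" and ?H = "{..<H} \<times> {..<H}"
  define F where "F = (\<lambda>n. (norm (\<Sum>i<H. unit_char (of_nat i * g n)))\<^sup>2)"
  define T where "T = (\<lambda>h::int. \<Sum>n\<in>?I. unit_char (of_int h * g n))"
  \<comment> \<open>The main term: each diagonal pair contributes exactly \<open>N\<close>, in total
    \<open>H N\<close>.\<close>
  define \<delta> where "\<delta> = (\<lambda>(i::nat, j::nat). if i = j then complex_of_nat N else 0)"
  have F: "complex_of_real (F n) = (\<Sum>(i, j)\<in>?H. unit_char (of_int (int i - int j) * g n))" for n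
  proof -
    have "complex_of_real (F n) =
        (\<Sum>i<H. unit_char (of_nat i * g n)) * cnj (\<Sum>i<H. unit_char (of_nat i * g n))"
      unfolding F_def by (simp only: complex_norm_square)
    also have "\<dots> = (\<Sum>(i, j)\<in>?H. unit_char (of_nat i * g n) * cnj (unit_char (of_nat j * g n)))"
      by (simp add: sum_product sum.cartesian_product)
    also have "\<dots> = (\<Sum>(i, j)\<in>?H. unit_char (of_int (int i - int j) * g n))"
      by (simp add: unit_char_diff[symmetric] left_diff_distrib)
    finally show ?thesis .
  qed
  have "complex_of_real (\<Sum>n\<in>?I. F n) = (\<Sum>(i, j)\<in>?H. T (int i - int j))"
    unfolding of_real_sum F T_def by (subst sum.swap) (simp add: case_prod_unfold)
  moreover have "(\<Sum>z\<in>?H. \<delta> z) = complex_of_real (real H * real N)"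
    by (simp add: \<delta>_def sum.cartesian_product[symmetric])
  ultimately have "complex_of_real ((\<Sum>n\<in>?I. F n) - real H * real N) =
      (\<Sum>z\<in>?H. (case z of (i, j) \<Rightarrow> T (int i - int j)) - \<delta> z)"
    by (simp add: sum_subtractf)
  then have "norm (complex_of_real ((\<Sum>n\<in>?I. F n) - real H * real N)) \<le>
      (\<Sum>z\<in>?H. norm ((case z of (i, j) \<Rightarrow> T (int i - int j)) - \<delta> z))"
    by (simp only: norm_sum)
  \<comment> \<open>At most \<open>H^2\<close> off-diagonal pairs with error
    \<open>N / (2 H)\<close> each lose only half of the main term.\<close>
  also have "\<dots> \<le> (\<Sum>z\<in>?H. N / (2 * H))"
  proof (rule sum_mono)
    fix z assume "z \<in> ?H"
    then obtain i j where ij: "z = (i, j)" "i < H" "j < H"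
      by auto
    show "norm ((case z of (i, j) \<Rightarrow> T (int i - int j)) - \<delta> z) \<le> N / (2 * H)"
    proof (cases "i = j")
      case True
      have "T 0 = of_nat N"
        by (simp add: T_def)
      then show ?thesis
        using True by (simp add: ij \<delta>_def)
    next
      case False
      then have "int i - int j \<noteq> 0" "\<bar>int i - int j\<bar> < int H"
        using ij by auto
      from bound[OF this] have "norm (T (int i - int j)) \<le> N / (2 * H)"
        by (simp only: T_def)
      then show ?thesis
        using False by (simp add: ij \<delta>_def)
    qed
  qed
  also have "\<dots> = real H * N / 2"
    using H by simp
  finally have "real H * N / 2 \<le> (\<Sum>n\<in>?I. F n)"
    unfolding norm_of_real by linarith
  also have "\<dots> \<le> (\<Sum>n\<in>?I. real H / 4)"
  proof (rule sum_mono)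
    fix n assume n: "n \<in> ?I"
    have pos: "2 / sqrt H > 0"
      using H by simp
    have gpos: "nearest_int_dist (g n) > 0"
      using far[OF n] pos by linarith
    have "norm (\<Sum>i<H. unit_char (of_nat i * g n)) \<le> 1 / nearest_int_dist (g n)"
      by (rule norm_geometric_unit_char_le[OF gpos])
    also have "\<dots> \<le> 1 / (2 / sqrt H)"
      using far[OF n] mult_pos_pos[OF gpos pos] by (intro divide_left_mono) auto
    also have "\<dots> = sqrt H / 2"
      by simp
    finally have "F n \<le> (sqrt H / 2)\<^sup>2"
      unfolding F_def by (intro power_mono) auto
    then show "F n \<le> real H / 4"
      by (simp add: power_divide)
  qed
  also have "\<dots> = real H * N / 4"
    by simp
  finally show False
    using H N by simp
qed

text \<open>An irrational number has reduced approximations \<open>a / q\<close> with error below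
  \<open>1 / q^2\<close> and \<open>q\<close> arbitrarily large. For
  \<open>0 < m \<le> q / 2\<close>, \<open>q\<close> does not divide \<open>m a\<close>, so
  \<open>m a / q\<close> is at least \<open>1 / q\<close> from the integers, and replacing
  \<open>a / q\<close> by \<open>\<alpha>\<close> loses at most half of that.\<close>

lemma irrational_far_multiples:
  fixes \<alpha> :: real and q0 :: nat
  assumes "\<alpha> \<notin> \<rat>"
  shows "\<exists>q>q0. \<forall>m>0. 2 * m \<le> q \<longrightarrow> 1 / (2 * real q) \<le> nearest_int_dist (of_nat m * \<alpha>)"
proof -
  have "infinite (approx_set \<alpha>)"
    using assms rational_iff_finite_approx_set by blast
  then obtain a k where "(a, k) \<in> approx_set \<alpha>" and k: "k > int q0"
    using infinite_approx_set by blast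
  then have cop: "coprime a k" and approx: "\<bar>\<alpha> - of_int a / of_int k\<bar> < 1 / (of_int k)\<^sup>2"
    by (auto simp: approx_set_def)
  define q where "q = nat k"
  have q: "k = int q" "q > q0"
    using k by (auto simp: q_def)
  have "1 / (2 * real q) \<le> nearest_int_dist (of_nat m * \<alpha>)" if m: "m > 0" "2 * m \<le> q" for m
  proof -
    define r where "r = round (of_nat m * \<alpha>)"
    have "\<not> k dvd int m"
      using m q by (auto dest!: zdvd_imp_le)
    then have "int m * a - r * k \<noteq> 0"
      using cop by (metis coprime_commute coprime_dvd_mult_left_iff dvd_triv_right eq_iff_diff_eq_0)
    then have one: "1 \<le> \<bar>real_of_int (int m * a - r * k)\<bar>"
      by linarith
    have eq: "of_nat m * \<alpha> - of_int r =
        of_int (int m * a - r * k) / real q + real m * (\<alpha> - of_int a / of_int k)"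
      using q m by (simp add: field_simps)
    have "\<bar>real m * (\<alpha> - of_int a / of_int k)\<bar> \<le> real m * (1 / (real q)\<^sup>2)"
      using mult_left_mono[OF less_imp_le[OF approx], of "real m"] q(1) by (simp add: abs_mult)
    also have "\<dots> \<le> (real q / 2) * (1 / (real q)\<^sup>2)"
      using m by (intro mult_right_mono) auto
    also have "\<dots> = 1 / (2 * real q)"
      by (simp add: power2_eq_square)
    finally have small: "\<bar>real m * (\<alpha> - of_int a / of_int k)\<bar> \<le> 1 / (2 * real q)" .
    have "1 / real q \<le> \<bar>of_int (int m * a - r * k) / real q\<bar>"
      unfolding abs_divide using one by (auto intro!: divide_right_mono)
    then have "2 * (1 / (2 * real q)) \<le> \<bar>of_int (int m * a - r * k) / real q\<bar>"
      by simp
    moreover have "c \<le> \<bar>x + y\<bar>" if "2 * c \<le> \<bar>x\<bar>" "\<bar>y\<bar> \<le> c" for c x y :: real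
      using that by linarith
    ultimately have "1 / (2 * real q) \<le> \<bar>of_nat m * \<alpha> - of_int r\<bar>"
      unfolding eq using small by blast
    then show ?thesis
      by (simp add: nearest_int_dist_def r_def)
  qed
  then show ?thesis
    using q(2) by blast
qed

text \<open>Since \<open>D\<close> does not depend on \<open>H\<close>, the bound on
  \<open>N\<close> later turns \<open>2 / sqrt H\<close> into a power of \<open>n\<close>.\<close>

lemma polynomial_close_to_int:
  fixes p :: "real poly" and j K :: nat
  assumes deg: "degree p = Suc j" and irr: "lead_coeff p \<notin> \<rat>" and K: "K = 2 ^ j"
  shows "\<exists>D::nat. \<forall>H0. \<exists>H\<ge>H0. \<exists>N n. H \<le> N \<and> N \<le> D * H ^ (K * K + 1) \<and> N \<le> n \<and> n < 2 * N \<and>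
    nearest_int_dist (poly p (of_nat n)) < 2 / sqrt H"
proof -
  define \<alpha> where "\<alpha> = lead_coeff p"
  define E where "E = K * (K - 1) + 1"
  \<comment> \<open>With \<open>b = 6 H\<close>, \<open>M * H ^ E\<close> is twice the bound
    \<open>b ^ (K * (K - 1)) * H * fact (Suc j)\<close> for the multipliers of
    \<open>\<alpha>\<close> that occur below.\<close>
  define M :: nat where "M = 2 * fact (Suc j) * 6 ^ (K * (K - 1))"
  define D where "D = 2 * K * (M * 2 ^ E) * 6 ^ K"
  have K1: "K \<ge> 1" and M1: "M \<ge> 1" and E1: "E \<ge> 1"
    by (auto simp: K M_def E_def Suc_le_eq)
  have EK: "E + K = K * K + 1"
    using K1 by (cases K) (auto simp: E_def)
  have "\<exists>H\<ge>H0. \<exists>N n. H \<le> N \<and> N \<le> D * H ^ (K * K + 1) \<and> N \<le> n \<and> n < 2 * N \<and>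
    nearest_int_dist (poly p (of_nat n)) < 2 / sqrt H" for H0
  proof -
    obtain q where q0: "q > M * Suc H0 ^ E"
      and q: "\<And>m. m > 0 \<Longrightarrow> 2 * m \<le> q \<Longrightarrow> 1 / (2 * real q) \<le> nearest_int_dist (of_nat m * \<alpha>)"
      using irrational_far_multiples irr unfolding \<alpha>_def by metis
    \<comment> \<open>The denominator \<open>q\<close> cannot be prescribed, so \<open>H\<close> is
      fitted to it: \<open>M * H ^ E \<le> q < M * Suc H ^ E\<close>. The lower bound is minimality
      at \<open>H - 1\<close>, hence the need for \<open>H \<ge> 1\<close>.\<close>
    define H where "H = (LEAST H. q < M * Suc H ^ E)"
    have "q < M * Suc q ^ E"
    proof -
      have "Suc q \<le> Suc q ^ E"
        using E1 by (intro self_le_power) auto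
      also have "\<dots> \<le> M * Suc q ^ E"
        using M1 by simp
      finally show ?thesis
        by simp
    qed
    then have qH: "q < M * Suc H ^ E"
      unfolding H_def by (rule LeastI)
    have "H0 < H"
    proof (rule ccontr)
      assume "\<not> H0 < H"
      then have "M * Suc H ^ E \<le> M * Suc H0 ^ E"
        by (intro mult_left_mono power_mono) auto
      then show False
        using q0 qH by linarith
    qed
    then have H1: "H \<ge> 1" and H0: "H \<ge> H0"
      by auto
    have MH: "M * H ^ E \<le> q"
      using not_less_Least[of "H - 1" "\<lambda>H. q < M * Suc H ^ E"] H1 by (simp add: H_def[symmetric])
    \<comment> \<open>The factor 6 turns the Weyl bound \<open>3 N / b\<close> into the
      \<open>N / (2 H)\<close> needed for Fejer's kernel; \<open>N\<close> is exactly the lower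
      bound \<open>2 ^ j * R * b ^ K\<close> with \<open>R = 2 q\<close>.\<close>
    define b where "b = 6 * H"
    define N where "N = 2 * K * q * b ^ K"
    have b1: "b \<ge> 1"
      using H1 by (simp add: b_def)
    have bM: "2 * fact (Suc j) * (b ^ (K * (K - 1)) * H) = M * H ^ E"
      by (simp add: M_def E_def b_def power_mult_distrib)
    have bq: "b ^ (K * (K - 1)) \<le> q"
    proof -
      have "b ^ (K * (K - 1)) * 1 \<le> (b ^ (K * (K - 1)) * H) * (2 * fact (Suc j))"
        using H1 unfolding mult.assoc by (intro mult_le_mono) (auto simp: Suc_le_eq)
      then show ?thesis
        using bM MH by (simp only: mult_ac)
    qed
    have q1: "q \<ge> 1"
      using bq b1 one_le_power[of b] by (meson le_trans)
    have bK1: "b ^ K \<ge> 1"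
      using b1 by simp
    have qN: "q \<le> N" "q * b ^ K \<le> N"
      using K1 bK1 mult_le_mono[of 1 "2 * K" "q * b ^ K" "q * b ^ K"] mult_le_mono[of q q 1 "b ^ K"]
      by (auto simp: N_def mult_ac)
    have HN: "H \<le> N"
    proof -
      have "1 * H ^ 1 \<le> M * H ^ E"
        using H1 E1 M1 by (intro mult_le_mono power_increasing)
      then show ?thesis
        using MH qN by simp
    qed
    have ND: "N \<le> D * H ^ (K * K + 1)"
    proof -
      \<comment> \<open>Replacing \<open>Suc H\<close> by \<open>2 H\<close> makes the bound on
        \<open>q\<close> a pure power of \<open>H\<close>.\<close>
      have "Suc H ^ E \<le> (2 * H) ^ E"
        using H1 by (intro power_mono) auto
      then have "q \<le> M * (2 * H) ^ E"
        using qH by (meson le_trans less_imp_le mult_le_mono2)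
      then have "N \<le> 2 * K * (M * (2 * H) ^ E) * (6 * H) ^ K"
        unfolding N_def b_def by (intro mult_le_mono) auto
      also have "\<dots> = D * H ^ (E + K)"
        by (simp add: D_def power_mult_distrib power_add)
      finally show ?thesis
        by (simp only: EK)
    qed
    have sum: "norm (\<Sum>n\<in>{int N..<int N + int N}. unit_char (of_int h * poly p (of_int n))) \<le> N / (2 * H)"
      if h: "h \<noteq> 0" "\<bar>h\<bar> < int H" for h
    proof -
      let ?\<beta> = "of_int h * (fact (Suc j) * \<alpha>)"
      have phase: "weyl_phase j ?\<beta> (\<lambda>n. of_int h * poly p (of_int n))"
        using weyl_phase_poly[of p j] deg by (intro weyl_phase_scale) (simp add: \<alpha>_def)
      have far: "far_multiples (b ^ (K * (K - 1))) (real (2 * q)) ?\<beta>"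
        unfolding far_multiples_def
      proof
        fix m assume m: "m \<in> {1..b ^ (K * (K - 1))}"
        \<comment> \<open>Up to sign, \<open>m * ?\<beta>\<close> is the integer multiple
          \<open>m' * \<alpha>\<close>, and \<open>m'\<close> stays within
          \<open>q / 2\<close>.\<close>
        define m' where "m' = m * nat \<bar>h\<bar> * fact (Suc j)"
        have "m' > 0"
          using m h by (auto simp: m'_def)
        moreover have "2 * m' \<le> q"
        proof -
          have "m * nat \<bar>h\<bar> \<le> b ^ (K * (K - 1)) * H"
            using m h by (intro mult_le_mono) auto
          then have "2 * fact (Suc j) * (m * nat \<bar>h\<bar>) \<le> 2 * fact (Suc j) * (b ^ (K * (K - 1)) * H)"
            by (rule mult_le_mono2)
          moreover have "2 * m' = 2 * fact (Suc j) * (m * nat \<bar>h\<bar>)"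
            by (simp only: m'_def mult_ac)
          ultimately have "2 * m' \<le> 2 * fact (Suc j) * (b ^ (K * (K - 1)) * H)"
            by simp
          then show ?thesis
            using bM MH by linarith
        qed
        ultimately have le: "1 / (2 * real q) \<le> nearest_int_dist (of_nat m' * \<alpha>)"
          by (rule q)
        have m': "real m' = real m * \<bar>real_of_int h\<bar> * fact (Suc j)"
          by (simp add: m'_def del: fact_Suc)
        have "nearest_int_dist (of_nat m' * \<alpha>) = nearest_int_dist (real m * ?\<beta>)"
        proof (cases "h > 0")
          case True
          then show ?thesis
            by (simp add: m' mult_ac del: fact_Suc)
        next
          case False
          then have "of_nat m' * \<alpha> = - (real m * ?\<beta>)"
            by (simp add: m' mult_ac del: fact_Suc)
          then show ?thesis
            by (simp only: nearest_int_dist_minus)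
        qed
        then show "1 / real (2 * q) \<le> nearest_int_dist (real m * ?\<beta>)"
          using le by simp
      qed
      have "K * K = K * (K - 1) + K"
        using K1 by (cases K) auto
      then have "b ^ (K * K) = b ^ (K * (K - 1)) * b ^ K"
        by (simp only: power_add)
      also have "\<dots> \<le> q * b ^ K"
        using bq by simp
      finally have "b ^ (K * K) \<le> N"
        using qN by linarith
      moreover have "2 ^ j * (2 * q) * b ^ K \<le> N"
        by (simp add: N_def K mult_ac)
      ultimately have "norm (\<Sum>n\<in>{int N..<int N + int N}. unit_char (of_int h * poly p (of_int n))) \<le> 3 * N / b"
        using q1 by (intro weyl_sum_bound[OF phase K b1 _ far]) auto
      also have "\<dots> = N / (2 * H)"
        using H1 by (simp add: b_def)
      finally show ?thesis .
    qed
    have "N \<ge> 1"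
      using HN H1 by linarith
    from exists_close_to_int[OF H1 this sum]
    obtain n where n: "n \<in> {int N..<int N + int N}" "nearest_int_dist (poly p (of_int n)) < 2 / sqrt H"
      by blast
    then have "N \<le> nat n" "nat n < 2 * N" "nearest_int_dist (poly p (of_nat (nat n))) < 2 / sqrt H"
      by auto
    then show ?thesis
      using H0 HN ND by blast
  qed
  then show ?thesis
    by blast
qed

text \<open>For a nonpositive exponent the worst case is the largest \<open>x\<close>, giving a
  constant times \<open>H\<close> to the power \<open>p t\<close>; this decays more slowly than the
  inverse square root.\<close>

lemma eventually_inverse_sqrt_less_powr:
  fixes C t :: real and p :: nat
  assumes C: "C \<ge> 1" and t: "real p * t > - 1 / 2"
  shows "eventually (\<lambda>H::nat. \<forall>x. 1 \<le> x \<longrightarrow> x \<le> C * real H ^ p \<longrightarrow> 2 / sqrt H < x powr t) at_top"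
proof -
  \<comment> \<open>Capping at 0 makes \<open>x powr s\<close> nonincreasing in \<open>x\<close>;
    \<open>x \<ge> 1\<close> permits returning to \<open>t\<close>.\<close>
  define s where "s = min t 0"
  have s: "s \<le> 0" "s \<le> t" "real p * s + 1 / 2 > 0"
    using t by (auto simp: s_def min_def)
  have "filterlim (\<lambda>H::nat. real H powr (real p * s + 1 / 2)) at_top at_top"
    by (rule filterlim_compose[OF real_powr_at_top[OF s(3)] filterlim_real_sequentially])
  then have "eventually (\<lambda>H::nat. real H powr (real p * s + 1 / 2) > 2 / C powr s) at_top"
    by (simp add: filterlim_at_top_dense)
  then show ?thesis
    using eventually_gt_at_top[of 0]
  proof eventually_elim
    case (elim H)
    show ?case
    proof (intro allI impI)
      fix x assume x: "1 \<le> x" "x \<le> C * real H ^ p"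
      have "2 < C powr s * real H powr (real p * s + 1 / 2)"
        using elim C by (simp add: field_simps)
      also have "\<dots> = (C powr s * real H powr (real p * s)) * sqrt H"
        using elim by (simp add: powr_add powr_half_sqrt)
      finally have "2 / sqrt H < C powr s * real H powr (real p * s)"
        using elim by (simp add: field_simps)
      also have "\<dots> = (C * real H ^ p) powr s"
        using C elim by (simp add: powr_mult powr_powr powr_realpow[symmetric])
      also have "\<dots> \<le> x powr s"
        using x s by (intro powr_mono2') auto
      also have "\<dots> \<le> x powr t"
        using x s by (intro powr_mono) auto
      finally show "2 / sqrt H < x powr t" .
    qed
  qed
qed

section \<open>Conclusion along even integers\<close>

lemma divisor_count_double_ge_3:
  assumes "m \<ge> 2"
  shows "divisor_count (2 * m) \<ge> 3"
proof -
  have "card {1, 2, 2 * m} \<le> card {d. d dvd 2 * m}"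
    using assms by (intro card_mono) auto
  then show ?thesis
    using assms by (simp add: divisor_count_def)
qed

theorem theorem1p5:
  fixes f :: "real poly" and k :: nat and \<gamma> \<epsilon> :: real
  assumes "degree f = k" and "k \<ge> 1"
    and "lead_coeff f \<notin> \<rat>"
    and "\<gamma> = 4 powr (1 - real k)"
    and "\<epsilon> > 0"
  shows "infinite {n :: nat. n > 0 \<and> divisor_count n \<ge> 3 \<and>
           nearest_int_dist (poly f (real n)) < real n powr (- \<gamma> / 4 + \<epsilon>)}"
proof -
  obtain j where k: "k = Suc j"
    using assms(2) by (metis One_nat_def Suc_le_D)
  define p where "p = pcompose f [:0, 2:]"
  define K :: nat where "K = 2 ^ j"
  define t where "t = - \<gamma> / 4 + \<epsilon>"
  have deg: "degree p = Suc j"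
    using assms(1) k by (simp add: p_def degree_pcompose)
  have lead: "lead_coeff p = lead_coeff f * 2 ^ k"
    unfolding p_def using assms(1) by (subst lead_coeff_comp) auto
  have "lead_coeff p \<notin> \<rat>"
  proof
    assume "lead_coeff p \<in> \<rat>"
    then have "lead_coeff p / 2 ^ k \<in> \<rat>"
      by (intro Rats_divide Rats_power) auto
    then show False
      using assms(3) by (simp add: lead)
  qed
  from polynomial_close_to_int[OF deg this K_def] obtain D where
    D: "\<And>H0. \<exists>H\<ge>H0. \<exists>N n. H \<le> N \<and> N \<le> D * H ^ (K * K + 1) \<and> N \<le> n \<and> n < 2 * N \<and>
      nearest_int_dist (poly p (of_nat n)) < 2 / sqrt H"
    by blast
  \<comment> \<open>The factor 4 comes from \<open>n = 2 m < 4 N\<close>.\<close>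
  define C where "C = max 1 (4 * real D)"
  have KK: "real (K * K) = 4 ^ j"
    by (simp add: K_def power_mult_distrib[symmetric])
  have \<gamma>: "\<gamma> = 1 / (K * K)"
    using assms(4) unfolding KK k by (simp add: powr_minus powr_realpow divide_inverse)
  \<comment> \<open>The product of \<open>K * K + 1\<close> and \<open>\<gamma> / 4\<close> is
    \<open>1 / 4 + 1 / (4 K^2)\<close>, at most one half; \<open>\<epsilon>\<close> supplies
    strictness.\<close>
  have "real (K * K + 1) * t > - 1 / 2"
  proof -
    have KK1: "real (K * K) \<ge> 1"
      unfolding KK by simp
    then have "real (K * K + 1) * (\<gamma> / 4) \<le> 1 / 2"
      unfolding \<gamma> by (simp add: field_simps)
    moreover have "real (K * K + 1) * \<epsilon> > 0"
      using assms(5) by (intro mult_pos_pos) (simp_all add: add_pos_nonneg)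
    moreover have "real (K * K + 1) * t = real (K * K + 1) * \<epsilon> - real (K * K + 1) * (\<gamma> / 4)"
      by (simp add: t_def algebra_simps)
    ultimately show ?thesis
      by linarith
  qed
  from eventually_inverse_sqrt_less_powr[OF _ this, of C] obtain H1 where
    H1: "\<And>H x. H \<ge> H1 \<Longrightarrow> 1 \<le> x \<Longrightarrow> x \<le> C * real H ^ (K * K + 1) \<Longrightarrow> 2 / sqrt (real H) < x powr t"
    by (auto simp: C_def eventually_at_top_linorder)
  show ?thesis
    unfolding infinite_nat_iff_unbounded
  proof
    fix n0 :: nat
    \<comment> \<open>As \<open>m \<ge> N \<ge> H\<close>, the summand 2 secures
      \<open>m \<ge> 2\<close> and the summand \<open>n0\<close> secures
      \<open>2 m > n0\<close>.\<close>
    obtain H N m where H: "H \<ge> H1 + n0 + 2" "H \<le> N" "N \<le> D * H ^ (K * K + 1)" "N \<le> m" "m < 2 * N"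
      and close: "nearest_int_dist (poly p (of_nat m)) < 2 / sqrt H"
      using D by blast
    have "2 * m \<le> 4 * (D * H ^ (K * K + 1))"
      using H by linarith
    then have "real (2 * m) \<le> real (4 * (D * H ^ (K * K + 1)))"
      by (simp only: of_nat_le_iff)
    also have "\<dots> = (4 * real D) * real H ^ (K * K + 1)"
      by simp
    also have "\<dots> \<le> C * real H ^ (K * K + 1)"
      by (intro mult_right_mono) (auto simp: C_def)
    finally have "2 / sqrt H < real (2 * m) powr t"
      using H by (intro H1) auto
    moreover have "poly p (of_nat m) = poly f (real (2 * m))"
      by (simp add: p_def poly_pcompose mult.commute)
    ultimately have "nearest_int_dist (poly f (real (2 * m))) < real (2 * m) powr (- \<gamma> / 4 + \<epsilon>)"
      using close by (simp add: t_def)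
    then show "\<exists>n>n0. n \<in> {n. n > 0 \<and> divisor_count n \<ge> 3 \<and>
        nearest_int_dist (poly f (real n)) < real n powr (- \<gamma> / 4 + \<epsilon>)}"
      using H divisor_count_double_ge_3[of m] by (intro exI[of _ "2 * m"]) auto
  qed
qed

end
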